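(* Let $T$ be a rectangle. There exists an integer $n_0 = n_0(T)$, depending only on $T$, such that for every positive integer $r$ and all integers $n \ge n_0$, \[ \mathbb{E}^{n} \overset{r}{\rightarrow} (T; T)_{\mathrm{GR}}, \] that is, for every coloring $\chi : \mathbb{E}^n \to \{1,\dots,r\}$ there exists in $\mathbb{E}^n$ a monochromatic congruent copy of $T$ or a rainbow congruent copy of $T$.
   Context: $\mathbb{E}^n$ denotes $n$-dimensional Euclidean space. A rectangle $T$ is regarded as the four-point configuration consisting of the vertices of a (non-degenerate) rectangle with arbitrary positive real side lengths. A congruent copy of a finite configuration $K$ is a set of points isometric to $K$. A copy is monochromatic if all its points receive the same color, and rainbow if all its points receive pairwise distinct colors. For finite configurations $K_1, K_2$, the notation $\mathbb{E}^n \overset{r}{\rightarrow} (K_1;K_2)_{\mathrm{GR}}$ means: every coloring $\chi:\mathbb{E}^n\to\{1,\dots,r\}$ contains a monochromatic congruent copy of $K_1$ or a rainbow congruent copy of $K_2$. *)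

theory Defs
  imports "HOL-Analysis.Analysis"
begin

text \<open>The dimension is quantified inside the statement, so n-dimensional Euclidean space is the
  library's \<^const>\<open>Euclidean_space\<close>, whose points are the functions \<open>x :: nat \<Rightarrow> real\<close> with
  \<open>x i = 0\<close> for \<open>i \<ge> n\<close>. The library provides only its topology; \<open>edist\<close> is the Euclidean
  distance.\<close>

abbreviation espace :: "nat \<Rightarrow> (nat \<Rightarrow> real) set" where
  "espace n \<equiv> topspace (Euclidean_space n)"

definition edist :: "nat \<Rightarrow> (nat \<Rightarrow> real) \<Rightarrow> (nat \<Rightarrow> real) \<Rightarrow> real" where
  "edist n x y = L2_set (\<lambda>i. x i - y i) {..<n}"

definition congruent_copy :: "nat \<Rightarrow> 'a::metric_space set \<Rightarrow> (nat \<Rightarrow> real) set \<Rightarrow> bool" where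
  "congruent_copy n K S \<longleftrightarrow> S \<subseteq> espace n \<and>
     (\<exists>f. bij_betw f K S \<and> (\<forall>x\<in>K. \<forall>y\<in>K. edist n (f x) (f y) = dist x y))"

definition monochromatic :: "('p \<Rightarrow> nat) \<Rightarrow> 'p set \<Rightarrow> bool" where
  "monochromatic col S \<longleftrightarrow> col constant_on S"

definition rainbow :: "('p \<Rightarrow> nat) \<Rightarrow> 'p set \<Rightarrow> bool" where
  "rainbow col S \<longleftrightarrow> inj_on col S"

definition GR_arrow :: "nat \<Rightarrow> nat \<Rightarrow> 'a::metric_space set \<Rightarrow> 'b::metric_space set \<Rightarrow> bool" where
  "GR_arrow n r K1 K2 \<longleftrightarrow>
     (\<forall>col \<in> espace n \<rightarrow> {1..r}.
        (\<exists>S. congruent_copy n K1 S \<and> monochromatic col S) \<or>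
        (\<exists>S. congruent_copy n K2 S \<and> rainbow col S))"

text \<open>The vertex set of a non-degenerate rectangle with a vertex \<open>p\<close> and perpendicular side
  vectors \<open>u\<close>, \<open>v\<close>.\<close>

definition is_rectangle :: "'a::euclidean_space set \<Rightarrow> bool" where
  "is_rectangle T \<longleftrightarrow>
     (\<exists>p u v. u \<noteq> 0 \<and> v \<noteq> 0 \<and> u \<bullet> v = 0 \<and> T = {p, p + u, p + u + v, p + v})"

end

(* A canonical Ramsey theorem for grids: on a suitable subgrid of a large m-dimensional grid, the
   colour of a point determines, and is determined by, its coordinates in some set R, however many
   colours there are.  Realise the grid as a product of regular simplices of two sizes, with squared
   sides 2x^2 and 2y^2 such that |u|^2 = 2(M x^2 + y^2) and |v|^2 = 2(x^2 + M y^2), and M + 2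
   simplices of each size.  Moving the coordinates in J and in K independently, for disjoint J and K
   consisting of M and 1, respectively 1 and M, simplices of the two sizes, gives a copy of T.  If R
   has at least two elements, let J and K both meet R: the copy is rainbow.  Otherwise let J and K
   both avoid R: the copy is monochromatic. *)

theory Submission
  imports "HOL-Library.Ramsey" Defs
begin

section \<open>Ramsey's theorem for an arbitrary finite colour set\<close>

text \<open>The colours used later are relations between index sets rather than numbers; a bijection
  onto \<open>{..<card C}\<close> carries the numbered form of Ramsey's theorem over to
  them.\<close>

lemma ramsey_finite_colours:
  assumes "finite C"
  shows "\<exists>N::nat. \<forall>f \<in> nsets {..<N} r \<rightarrow> C. \<exists>H\<in>nsets {..<N} q. \<exists>x. \<forall>S\<in>nsets H r. f S = x"
proof -
  obtain g where g: "bij_betw g C {..<card C}"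
    using assms finite_same_card_bij[of C "{..<card C}"] by auto
  obtain N :: nat where N: "partn_lst {..<N} (replicate (card C) q) r"
    using ramsey_full by blast
  have "\<exists>H\<in>nsets {..<N} q. \<exists>x. \<forall>S\<in>nsets H r. f S = x" if f: "f \<in> nsets {..<N} r \<rightarrow> C" for f
  proof -
    have "g \<circ> f \<in> nsets {..<N} r \<rightarrow> {..<card C}"
      using f bij_betwE[OF g] by fastforce
    then obtain i H where i: "H \<in> nsets {..<N} q" "(g \<circ> f) ` nsets H r \<subseteq> {i}"
      using N unfolding partn_lst_def Ramsey.monochromatic_def by fastforce
    have "f S = inv_into C g i" if "S \<in> nsets H r" for S
    proof -
      have "S \<in> nsets {..<N} r"
        using that i(1) nsets_mono[of H "{..<N}" r] by (auto simp: nsets_def)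
      with f have "f S \<in> C" by auto
      moreover have "g (f S) = i" using i(2) that by auto
      ultimately show ?thesis using g by (metis bij_betw_inv_into_left)
    qed
    with i show ?thesis by blast
  qed
  then show ?thesis by blast
qed

lemma sorted_list_of_set_image_strict_mono:
  fixes g :: "nat \<Rightarrow> nat"
  assumes "strict_mono_on {..<n} g"
  shows "sorted_list_of_set (g ` {..<n}) = map g [0..<n]"
proof -
  have "sorted_wrt (<) (map g [0..<n])"
    using assms by (auto simp: sorted_wrt_iff_nth_less strict_mono_on_def)
  then show ?thesis
    by (metis (no_types) strict_sorted_equal strict_sorted_list_of_set set_sorted_list_of_set
        set_map set_upt atLeast0LessThan finite_imageI finite_lessThan)
qed

section \<open>The canonical theorem for grids\<close>

text \<open>The colour type may be infinite, so Ramsey's theorem is applied not to \<open>c\<close>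
  but to the record of which corners of a box receive equal colours; the number of such records is
  bounded in terms of \<open>m\<close> alone. A set of \<open>2 * m\<close> numbers encodes a box
  with two levels per coordinate. On a homogeneous set the record is constant, so equality of
  colours depends on order patterns only, and \<open>R\<close> consists of the coordinates that can
  affect the colour.\<close>

theorem product_canonical_ramsey:
  fixes m k :: nat
  assumes k: "3 \<le> k"
  shows "\<exists>N. \<forall>c :: (nat \<Rightarrow> nat) \<Rightarrow> 'c. (\<forall>s t. (\<forall>j<m. s j = t j) \<longrightarrow> c s = c t) \<longrightarrow>
    (\<exists>R h. R \<subseteq> {..<m} \<and> (\<forall>j<m. inj_on (h j) {..<k} \<and> h j ` {..<k} \<subseteq> {..<N}) \<and>
      (\<forall>s t. (\<forall>j<m. s j < k \<and> t j < k) \<longrightarrow>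
        c (\<lambda>j. h j (s j)) = c (\<lambda>j. h j (t j)) \<longleftrightarrow> (\<forall>j\<in>R. s j = t j)))"
proof -
  define C where "C = Pow (Pow {..<m} \<times> Pow {..<m})"
  have "finite C" by (simp add: C_def)
  from ramsey_finite_colours[OF this, of "2 * m" "m * Suc k"]
  obtain N :: nat where N: "\<forall>f \<in> nsets {..<N} (2 * m) \<rightarrow> C.
      \<exists>H\<in>nsets {..<N} (m * Suc k). \<exists>x. \<forall>S\<in>nsets H (2 * m). f S = x" ..
  have main: "\<exists>R h. R \<subseteq> {..<m} \<and> (\<forall>j<m. inj_on (h j) {..<k} \<and> h j ` {..<k} \<subseteq> {..<N}) \<and>
      (\<forall>s t. (\<forall>j<m. s j < k \<and> t j < k) \<longrightarrow>
        c (\<lambda>j. h j (s j)) = c (\<lambda>j. h j (t j)) \<longleftrightarrow> (\<forall>j\<in>R. s j = t j))"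
    if "\<forall>s t. (\<forall>j<m. s j = t j) \<longrightarrow> c s = c t" for c :: "(nat \<Rightarrow> nat) \<Rightarrow> 'c"
  proof -
    have c: "c s = c t" if "\<forall>j<m. s j = t j" for s t
      using \<open>\<forall>s t. (\<forall>j<m. s j = t j) \<longrightarrow> c s = c t\<close> that by blast
    \<comment> \<open>The increasing enumeration of \<open>S\<close> is cut into \<open>m\<close>
      consecutive pairs. Corner \<open>A\<close> of the box takes the upper element of pair
      \<open>j\<close> if \<open>j\<close> is in \<open>A\<close>, and the lower one
      otherwise.\<close>
    define pt where "pt S A = (\<lambda>j. sorted_list_of_set S ! (2 * j + of_bool (j \<in> A)))"
      for S A :: "nat set"
    define f where "f S = {(A, B). A \<subseteq> {..<m} \<and> B \<subseteq> {..<m} \<and> c (pt S A) = c (pt S B)}" for S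
    have "f \<in> nsets {..<N} (2 * m) \<rightarrow> C"
      by (auto simp: f_def C_def)
    from bspec[OF N this] obtain H P where H: "H \<in> nsets {..<N} (m * Suc k)"
      and P: "\<And>S. S \<in> nsets H (2 * m) \<Longrightarrow> f S = P"
      by auto
    have finH: "finite H" and cardH: "card H = m * Suc k" and HN: "H \<subseteq> {..<N}"
      using H by (auto simp: nsets_def)
    define e where "e i = sorted_list_of_set H ! i" for i
    have lenH: "length (sorted_list_of_set H) = m * Suc k"
      using cardH by simp
    have e_less: "e i < e i'" if "i < i'" "i' < m * Suc k" for i i'
      using that lenH strict_sorted_list_of_set[of H] unfolding e_def sorted_wrt_iff_nth_less
      by simp
    have e_in: "e i \<in> H" if "i < m * Suc k" for i
      using that lenH finH unfolding e_def by (metis nth_mem set_sorted_list_of_set)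
    have idx: "j * Suc k + l < m * Suc k" if "j < m" "l \<le> k" for j l
    proof -
      have "j * Suc k + l < Suc j * Suc k" using that by simp
      also have "\<dots> \<le> m * Suc k" using that by (intro mult_le_mono1) simp
      finally show ?thesis .
    qed
    \<comment> \<open>\<open>H\<close> is cut into \<open>m\<close> blocks of \<open>k + 1\<close>
      consecutive elements, one block per coordinate. Each block lies wholly below the later ones,
      so two levels from every block, listed block by block, are already in increasing
      order.\<close>
    define h where "h j l = e (j * Suc k + l)" for j l
    have h_in: "h j l \<in> H" if "j < m" "l \<le> k" for j l
      unfolding h_def by (intro e_in idx that)
    have h_less: "h j l < h j l'" if "j < m" "l < l'" "l' \<le> k" for j l l'
      unfolding h_def using that by (intro e_less idx) auto
    have h_less': "h j l < h j' l'" if "j < j'" "j' < m" "l \<le> k" "l' \<le> k" for j j' l l'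
      unfolding h_def
    proof (intro e_less idx)
      have "j * Suc k + l < Suc j * Suc k" using that by simp
      also have "\<dots> \<le> j' * Suc k + l'" using that by (intro trans_le_add1 mult_le_mono1) simp
      finally show "j * Suc k + l < j' * Suc k + l'" .
    qed (use that in auto)
    define hc where "hc s = c (\<lambda>j. h j (s j))" for s
    have hc_cong: "hc s = hc t" if "\<And>j. j < m \<Longrightarrow> s j = t j" for s t
      unfolding hc_def using that by (intro c) simp
    define bd where "bd s \<longleftrightarrow> (\<forall>j<m. s j < k)" for s :: "nat \<Rightarrow> nat"
    \<comment> \<open>Whether two grid points get the same colour depends only on the coordinatewise order
      pattern. Where they agree, the level above the common one, which exists because each block
      has \<open>k + 1\<close> elements, completes the \<open>2m\<close>-subset.\<close>
    have pattern: "hc s = hc t \<longleftrightarrow> ({j. j < m \<and> t j < s j}, {j. j < m \<and> s j < t j}) \<in> P"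
      if st: "bd s" "bd t" for s t
    proof -
      define lo where "lo j = min (s j) (t j)" for j
      define hi where "hi j = (if s j = t j then Suc (s j) else max (s j) (t j))" for j
      define g where "g i = h (i div 2) (if even i then lo (i div 2) else hi (i div 2))" for i
      have lh: "lo j < hi j" "hi j \<le> k" "lo j \<le> k" if "j < m" for j
        using st that by (auto simp: lo_def hi_def bd_def less_imp_le Suc_le_eq)
      have mono: "strict_mono_on {..<2 * m} g"
      proof (rule strict_mono_onI)
        fix i i' assume i: "i \<in> {..<2 * m}" "i' \<in> {..<2 * m}" "i < i'"
        have m2: "i div 2 < m" "i' div 2 < m" using i by auto
        show "g i < g i'"
        proof (cases "i div 2 = i' div 2")
          case True
          then have "even i" "odd i'" using i(3) by presburger+
          then show ?thesis using True lh m2 by (auto simp: g_def intro!: h_less)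
        next
          case False
          then have "i div 2 < i' div 2" using i(3) by linarith
          then show ?thesis using lh m2 by (auto simp: g_def intro!: h_less')
        qed
      qed
      define S where "S = g ` {..<2 * m}"
      have sl: "sorted_list_of_set S = map g [0..<2 * m]"
        unfolding S_def by (rule sorted_list_of_set_image_strict_mono[OF mono])
      have "S \<in> nsets H (2 * m)"
      proof -
        have "S \<subseteq> H"
          using lh by (auto simp: S_def g_def intro!: h_in)
        moreover have "card S = 2 * m"
          using sl by (metis length_map length_upt minus_nat.diff_0 length_sorted_list_of_set)
        ultimately show ?thesis by (simp add: nsets_def S_def)
      qed
      then have fS: "f S = P" by (rule P)
      have nth: "pt S A j = g (2 * j + of_bool (j \<in> A))" if "j < m" for j A
        using that by (auto simp: pt_def sl)
      \<comment> \<open>Where \<open>t j < s j\<close>, the upper element \<open>hi j\<close> is the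
        level \<open>s j\<close>; everywhere else, ties included, the lower element
        \<open>lo j\<close> is. So this corner is \<open>s\<close>, and the opposite choice gives
        \<open>t\<close>.\<close>
      have "c (pt S {j. j < m \<and> t j < s j}) = hc s"
        unfolding hc_def by (rule c) (auto simp: nth g_def lo_def hi_def)
      moreover have "c (pt S {j. j < m \<and> s j < t j}) = hc t"
        unfolding hc_def by (rule c) (auto simp: nth g_def lo_def hi_def)
      ultimately have "hc s = hc t \<longleftrightarrow>
          ({j. j < m \<and> t j < s j}, {j. j < m \<and> s j < t j}) \<in> f S"
        by (auto simp: f_def)
      then show ?thesis by (simp add: fS)
    qed
    have transfer: "hc s = hc t \<longleftrightarrow> hc s' = hc t'"
      if "bd s" "bd t" "bd s'" "bd t'"
        and "\<And>j. j < m \<Longrightarrow> t j < s j \<longleftrightarrow> t' j < s' j" "\<And>j. j < m \<Longrightarrow> s j < t j \<longleftrightarrow> s' j < t' j"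
      for s t s' t'
      using that by (simp add: pattern cong: conj_cong)
    define irr where "irr j \<longleftrightarrow> (\<forall>s l. bd s \<longrightarrow> l < k \<longrightarrow> hc s = hc (s(j := l)))" for j
    define R where "R = {j. j < m \<and> \<not> irr j}"
    \<comment> \<open>All upward moves in coordinate \<open>j\<close> alone have the same order
      pattern, whatever the base point and the levels, so one that keeps the colour decides for all.
      A downward move is an upward one read backwards.\<close>
    have irr_up: "irr j" if "bd s" "s j < l" "l < k" "hc s = hc (s(j := l))" "j < m" for s j l
      unfolding irr_def
    proof (intro allI impI)
      fix t l' assume t: "bd t" "l' < k"
      have b: "bd (s(j := l))" "bd (t(j := l'))" using that t by (auto simp: bd_def)
      consider "l' = t j" | "t j < l'" | "l' < t j" by linarith
      then show "hc t = hc (t(j := l'))"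
      proof cases
        case 2
        then have "(hc s = hc (s(j := l))) = (hc t = hc (t(j := l')))"
          using that b t by (intro transfer) auto
        with that show ?thesis by simp
      next
        case 3
        then have "(hc s = hc (s(j := l))) = (hc (t(j := l')) = hc t)"
          using that b t by (intro transfer) auto
        with that show ?thesis by simp
      qed simp
    qed
    \<comment> \<open>If moving several coordinates at once preserves the colour, then so does moving one of
      them a level further, and hence moving this one alone.\<close>
    have irr_if: "irr j" if st: "bd s" "bd t" "hc s = hc t" "j < m" "s j < t j" for s t j
    proof -
      \<comment> \<open>The pattern of \<open>s\<close> and \<open>t\<close> is copied onto levels 0
        and 1. This leaves level 2, available by \<open>3 \<le> k\<close>, free above
        \<open>t' j = 1\<close>: raising \<open>t'\<close> to it does not alter the pattern against
        \<open>s'\<close>.\<close>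
      define s' where "s' i = (of_bool (t i < s i) :: nat)" for i
      define t' where "t' i = (of_bool (s i < t i) :: nat)" for i
      have b: "bd s'" "bd t'" "bd (t'(j := 2))"
        using k by (auto simp: bd_def s'_def t'_def)
      have "(hc s = hc t) = (hc s' = hc t')"
        using st b by (intro transfer) (auto simp: s'_def t'_def)
      moreover have "(hc s = hc t) = (hc s' = hc (t'(j := 2)))"
        using st b by (intro transfer) (auto simp: s'_def t'_def)
      ultimately have "hc t' = hc (t'(j := 2))" using st by simp
      then show ?thesis
        using irr_up[of t' j 2] b k st by (auto simp: t'_def)
    qed
    have irr_iff: "hc s = hc t \<longleftrightarrow> (\<forall>j\<in>R. s j = t j)" if st: "bd s" "bd t" for s t
    proof
      assume eq: "hc s = hc t"
      show "\<forall>j\<in>R. s j = t j"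
      proof (intro ballI, rule ccontr)
        fix j assume "j \<in> R" "s j \<noteq> t j"
        then show False
          using irr_if[OF st eq, of j] irr_if[OF st(2,1) eq[symmetric], of j]
          by (auto simp: R_def neq_iff)
      qed
    next
      assume agree: "\<forall>j\<in>R. s j = t j"
      \<comment> \<open>Turn \<open>s\<close> into \<open>t\<close> one coordinate at a time: a
        coordinate in \<open>R\<close> does not change, and any other is irrelevant to the
        colour.\<close>
      have "hc s = hc (\<lambda>j. if j < i then t j else s j)" if "i \<le> m" for i
        using that
      proof (induction i)
        case (Suc i)
        let ?u = "\<lambda>j. if j < i then t j else s j"
        have upd: "(\<lambda>j. if j < Suc i then t j else s j) = ?u(i := t i)"
          by (auto simp: less_Suc_eq)
        have "hc ?u = hc (?u(i := t i))"
        proof (cases "i \<in> R")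
          case True
          then show ?thesis using agree by (intro hc_cong) auto
        next
          case False
          then have "irr i" using Suc.prems by (simp add: R_def)
          moreover have "bd ?u" using st by (simp add: bd_def)
          moreover have "t i < k" using st Suc.prems by (simp add: bd_def)
          ultimately show ?thesis unfolding irr_def by blast
        qed
        then show ?case using Suc upd by simp
      qed simp
      from this[of m] have "hc s = hc (\<lambda>j. if j < m then t j else s j)" by simp
      also have "\<dots> = hc t" by (intro hc_cong) simp
      finally show "hc s = hc t" .
    qed
    have "inj_on (h j) {..<k}" if "j < m" for j
      by (rule linorder_inj_onI') (metis h_less[OF that] less_imp_le lessThan_iff less_irrefl)
    moreover have "h j ` {..<k} \<subseteq> {..<N}" if "j < m" for j
      using h_in[OF that] HN by (auto simp: less_imp_le subset_iff)
    moreover have "R \<subseteq> {..<m}" by (auto simp: R_def)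
    moreover have "\<forall>s t. (\<forall>j<m. s j < k \<and> t j < k) \<longrightarrow>
        c (\<lambda>j. h j (s j)) = c (\<lambda>j. h j (t j)) \<longleftrightarrow> (\<forall>j\<in>R. s j = t j)"
      using irr_iff by (simp add: hc_def bd_def)
    ultimately show ?thesis
      by (intro exI[of _ R] exI[of _ h]) simp
  qed
  show ?thesis
    by (intro exI[of _ N] allI impI, rule main)
qed

section \<open>Products of regular simplices\<close>

text \<open>A vertex of a product of \<open>m\<close> regular simplices with \<open>N\<close>
  vertices each: block \<open>j\<close> of \<open>N\<close> coordinates holds \<open>w j\<close>
  times the standard basis vector with index \<open>s j\<close>. The squared side of simplex
  \<open>j\<close> is thus \<open>2 * (w j)^2\<close>.\<close>

definition simplex_point :: "nat \<Rightarrow> nat \<Rightarrow> (nat \<Rightarrow> real) \<Rightarrow> (nat \<Rightarrow> nat) \<Rightarrow> nat \<Rightarrow> real" where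
  "simplex_point m N w s i = (if i < m * N \<and> s (i div N) = i mod N then w (i div N) else 0)"

lemma simplex_point_in_espace: "m * N \<le> n \<Longrightarrow> simplex_point m N w s \<in> espace n"
  by (auto simp: topspace_Euclidean_space simplex_point_def)

text \<open>Blocks are orthogonal, so squared distances add. A block where \<open>s\<close> and
  \<open>t\<close> differ contributes \<open>(w j)^2\<close> at each of two positions, both inside
  the block by the bounds on \<open>s\<close> and \<open>t\<close>.\<close>

lemma edist_simplex_point:
  assumes "m * N \<le> n" and s: "\<And>j. j < m \<Longrightarrow> s j < N" and t: "\<And>j. j < m \<Longrightarrow> t j < N"
  shows "edist n (simplex_point m N w s) (simplex_point m N w t) =
    sqrt (\<Sum>j | j < m \<and> s j \<noteq> t j. 2 * (w j)\<^sup>2)"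
proof -
  define d where "d i = (simplex_point m N w s i - simplex_point m N w t i)\<^sup>2" for i
  have block: "sum d {j * N..<j * N + N} = (if s j \<noteq> t j then 2 * (w j)\<^sup>2 else 0)" if j: "j < m" for j
  proof -
    have "sum d {j * N..<j * N + N} = (\<Sum>l<N. d (l + j * N))"
      using sum.shift_bounds_nat_ivl[of d 0 "j * N" N]
      by (simp add: atLeast0LessThan add.commute)
    also have "\<dots> = (\<Sum>l<N. if s j \<noteq> t j then
        (if l = s j then (w j)\<^sup>2 else 0) + (if l = t j then (w j)\<^sup>2 else 0) else 0)"
    proof (rule sum.cong)
      fix l assume "l \<in> {..<N}"
      then have l: "l < N" by simp
      have "l + j * N < Suc j * N" using l by simp
      also have "\<dots> \<le> m * N" using j by (intro mult_le_mono1) simp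
      finally show "d (l + j * N) = (if s j \<noteq> t j then
        (if l = s j then (w j)\<^sup>2 else 0) + (if l = t j then (w j)\<^sup>2 else 0) else 0)"
        using l by (auto simp: d_def simplex_point_def)
    qed simp
    also have "\<dots> = (if s j \<noteq> t j then 2 * (w j)\<^sup>2 else 0)"
      using s[OF j] t[OF j] by (simp add: sum.distrib)
    finally show ?thesis .
  qed
  have "sum d {..<n} = sum d {..<m * N}"
    using assms(1) by (intro sum.mono_neutral_right) (auto simp: d_def simplex_point_def)
  also have "\<dots> = (\<Sum>j<m. sum d {j * N..<j * N + N})"
    by (rule sum.nat_group[symmetric])
  also have "\<dots> = (\<Sum>j<m. if s j \<noteq> t j then 2 * (w j)\<^sup>2 else 0)"
    by (intro sum.cong) (auto simp: block)
  also have "\<dots> = (\<Sum>j | j < m \<and> s j \<noteq> t j. 2 * (w j)\<^sup>2)"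
    by (subst sum.inter_filter[symmetric]) (auto simp: lessThan_def)
  finally show ?thesis
    by (simp add: edist_def L2_set_def d_def)
qed

section \<open>Choice of coordinate sets and weights\<close>

text \<open>Reserve \<open>y\<close> for \<open>K\<close> while choosing \<open>J\<close>: since
  \<open>q\<close> is at least 1, enough elements remain. Membership is conditional because the
  lemma is applied to each class of simplices separately, and \<open>x\<close> and \<open>y\<close>
  may lie in different classes.\<close>

lemma disjoint_subsets_through:
  assumes "finite W" "p + q \<le> card W" "1 \<le> p" "1 \<le> q" "x \<noteq> y"
  shows "\<exists>J K. J \<subseteq> W \<and> K \<subseteq> W \<and> J \<inter> K = {} \<and> card J = p \<and> card K = q \<and>
    (x \<in> W \<longrightarrow> x \<in> J) \<and> (y \<in> W \<longrightarrow> y \<in> K)"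
proof -
  have "card (W - {y}) \<ge> p"
    using assms by (cases "y \<in> W") auto
  moreover have "card (W \<inter> {x}) \<le> p"
    using assms(3) card_mono[of "{x}" "W \<inter> {x}"] by simp
  ultimately obtain J where J: "W \<inter> {x} \<subseteq> J" "J \<subseteq> W - {y}" "card J = p"
    using exists_subset_between[of "W \<inter> {x}" p "W - {y}"] assms by blast
  have "card (W - J) \<ge> q"
    using J assms by (subst card_Diff_subset) (auto intro: finite_subset)
  moreover have "card (W \<inter> {y}) \<le> q"
    using assms(4) card_mono[of "{y}" "W \<inter> {y}"] by simp
  ultimately obtain K where K: "W \<inter> {y} \<subseteq> K" "K \<subseteq> W - J" "card K = q"
    using exists_subset_between[of "W \<inter> {y}" q "W - J"] J assms by blast
  have "J \<subseteq> W" "K \<subseteq> W" "J \<inter> K = {}" "x \<in> W \<longrightarrow> x \<in> J" "y \<in> W \<longrightarrow> y \<in> K"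
    using J K by auto
  with J(3) K(3) show ?thesis
    by (intro exI[of _ J] exI[of _ K]) simp
qed

text \<open>A linear system in the two squares with determinant \<open>M^2 - 1\<close>, solved by
  Cramer's rule; both solutions are positive once \<open>M\<close> exceeds 1, \<open>A / B\<close>
  and \<open>B / A\<close>. Both coefficients \<open>M\<close> and 1 are positive, so each side of
  the rectangle uses simplices of both sizes and can be made to include any prescribed
  simplex.\<close>

lemma positive_square_weights:
  fixes A B :: real
  assumes "A > 0" "B > 0"
  obtains M :: nat and x y :: real where "1 \<le> M"
    "A = M * x\<^sup>2 + y\<^sup>2" "B = x\<^sup>2 + M * y\<^sup>2"
proof -
  obtain M :: nat where M: "real M > 1 + A / B + B / A"
    using reals_Archimedean2 by blast
  have pos: "A / B > 0" "B / A > 0" using assms by auto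
  have M1: "real M > 1" and "real M > B / A" "real M > A / B" using M pos by linarith+
  then have MA: "M * A - B > 0" and MB: "M * B - A > 0"
    using assms by (auto simp: field_simps)
  have D: "(real M)\<^sup>2 - 1 > 0" using M1 by simp
  define x where "x = sqrt ((M * A - B) / ((real M)\<^sup>2 - 1))"
  define y where "y = sqrt ((M * B - A) / ((real M)\<^sup>2 - 1))"
  have xy: "x\<^sup>2 = (M * A - B) / ((real M)\<^sup>2 - 1)" "y\<^sup>2 = (M * B - A) / ((real M)\<^sup>2 - 1)"
    using MA MB D by (simp_all add: x_def y_def)
  have "M * x\<^sup>2 + y\<^sup>2 = (M * (M * A - B) + (M * B - A)) / ((real M)\<^sup>2 - 1)"
    "x\<^sup>2 + M * y\<^sup>2 = ((M * A - B) + M * (M * B - A)) / ((real M)\<^sup>2 - 1)"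
    unfolding xy by (simp_all add: add_divide_distrib)
  moreover have "M * (M * A - B) + (M * B - A) = A * ((real M)\<^sup>2 - 1)"
    by (simp add: algebra_simps power2_eq_square)
  moreover have "(M * A - B) + M * (M * B - A) = B * ((real M)\<^sup>2 - 1)"
    by (simp add: algebra_simps power2_eq_square)
  ultimately have "A = M * x\<^sup>2 + y\<^sup>2" "B = x\<^sup>2 + M * y\<^sup>2"
    using D by simp_all
  moreover have "1 \<le> M" using M1 by simp
  ultimately show thesis using that by blast
qed

section \<open>Recognising a copy of a rectangle\<close>

text \<open>Index the vertices by two switches, one per side. By Pythagoras the squared distance of
  two vertices is the sum of the squared sides whose switches differ, so the distances of
  \<open>q\<close> match; injectivity follows from the isometry.\<close>

lemma congruent_copy_rectangle:
  fixes p u v :: "'a::euclidean_space" and q :: "bool \<Rightarrow> bool \<Rightarrow> nat \<Rightarrow> real"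
  assumes uv: "u \<noteq> 0" "v \<noteq> 0" "u \<bullet> v = 0"
    and q: "\<And>x y. q x y \<in> espace n"
    and ed: "\<And>x y x' y'. edist n (q x y) (q x' y') =
      sqrt (of_bool (x \<noteq> x') * (norm u)\<^sup>2 + of_bool (y \<noteq> y') * (norm v)\<^sup>2)"
  shows "congruent_copy n {p, p + u, p + u + v, p + v} (range (\<lambda>(x, y). q x y))"
proof -
  define g where "g = (\<lambda>(x, y). p + of_bool x *\<^sub>R u + of_bool y *\<^sub>R v)"
  \<comment> \<open>As \<open>u\<close> and \<open>v\<close> are orthogonal, the inner products of
    \<open>z - p\<close> with them recover the two switches of a vertex \<open>z\<close>.\<close>
  define f where "f z = q ((z - p) \<bullet> u \<noteq> 0) ((z - p) \<bullet> v \<noteq> 0)" for z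
  have vu: "v \<bullet> u = 0" using uv by (simp add: inner_commute)
  have T: "{p, p + u, p + u + v, p + v} = range g"
    by (auto simp: g_def UNIV_bool simp flip: UNIV_Times_UNIV)
  have fg: "f (g (x, y)) = q x y" for x y
    using uv vu by (simp add: f_def g_def inner_add_left)
  have dg: "dist (g (x, y)) (g (x', y')) =
      sqrt (of_bool (x \<noteq> x') * (norm u)\<^sup>2 + of_bool (y \<noteq> y') * (norm v)\<^sup>2)" for x y x' y'
    using uv vu
    by (cases x; cases y; cases x'; cases y')
      (auto simp: g_def dist_norm norm_eq_sqrt_inner inner_add inner_diff)
  have iso: "edist n (f z) (f z') = dist z z'" if "z \<in> range g" "z' \<in> range g" for z z'
    using that by (auto simp: fg ed dg)
  have "inj_on f (range g)"
  proof (rule inj_onI)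
    fix z z' assume z: "z \<in> range g" "z' \<in> range g" "f z = f z'"
    have "dist z z' = edist n (f z) (f z')" by (rule iso[symmetric]) fact+
    also have "\<dots> = 0" by (simp add: z(3) edist_def L2_set_def)
    finally show "z = z'" by simp
  qed
  moreover have "f ` range g = range (\<lambda>(x, y). q x y)"
  proof -
    have "f \<circ> g = (\<lambda>(x, y). q x y)" by (auto simp: fun_eq_iff fg)
    then show ?thesis by (simp only: image_comp)
  qed
  ultimately have "bij_betw f (range g) (range (\<lambda>(x, y). q x y))"
    by (simp add: bij_betw_def)
  with iso q show ?thesis
    unfolding congruent_copy_def T by auto
qed

section \<open>Monochromatic or rainbow rectangles in the product\<close>

theorem theorem1p1:
  fixes T :: "'a::euclidean_space set"
  assumes "is_rectangle T"
  shows "\<exists>n0::nat. \<forall>r::nat. r \<ge> 1 \<longrightarrow> (\<forall>n\<ge>n0. GR_arrow n r T T)"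
proof -
  obtain p u v where uv: "u \<noteq> 0" "v \<noteq> 0" "u \<bullet> v = 0" and T: "T = {p, p + u, p + u + v, p + v}"
    using assms unfolding is_rectangle_def by blast
  \<comment> \<open>The halves compensate for the factor 2 in the squared side of a simplex.\<close>
  obtain M :: nat and x y :: real where M: "1 \<le> M"
    and A: "(norm u)\<^sup>2 / 2 = M * x\<^sup>2 + y\<^sup>2" and B: "(norm v)\<^sup>2 / 2 = x\<^sup>2 + M * y\<^sup>2"
    using positive_square_weights[of "(norm u)\<^sup>2 / 2" "(norm v)\<^sup>2 / 2"] uv by auto
  \<comment> \<open>Each class has \<open>M + 2\<close> simplices: discarding the at most one index
    of \<open>R\<close> in the monochromatic case still leaves the \<open>M + 1\<close> needed for
    disjoint sets of sizes \<open>M\<close> and 1.\<close>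
  define W where "W = {..<M + 2}"
  define V where "V = {M + 2..<2 * M + 4}"
  define m where "m = 2 * M + 4"
  define w where "w j = (if j < M + 2 then x else y)" for j :: nat
  have WV: "finite W" "finite V" "card W = M + 2" "card V = M + 2" "W \<inter> V = {}" "W \<union> V = {..<m}"
    by (auto simp: W_def V_def m_def)
  have "(3::nat) \<le> 3" by simp
  from product_canonical_ramsey[OF this, of m]
  obtain N where N: "\<forall>c :: (nat \<Rightarrow> nat) \<Rightarrow> nat. (\<forall>s t. (\<forall>j<m. s j = t j) \<longrightarrow> c s = c t) \<longrightarrow>
    (\<exists>R (h :: nat \<Rightarrow> nat \<Rightarrow> nat). R \<subseteq> {..<m} \<and> (\<forall>j<m. inj_on (h j) {..<3} \<and> h j ` {..<3} \<subseteq> {..<N}) \<and>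
      (\<forall>s t. (\<forall>j<m. s j < 3 \<and> t j < 3) \<longrightarrow>
        c (\<lambda>j. h j (s j)) = c (\<lambda>j. h j (t j)) \<longleftrightarrow> (\<forall>j\<in>R. s j = t j)))" ..
  have main: "(\<exists>S. congruent_copy n T S \<and> Defs.monochromatic col S) \<or>
      (\<exists>S. congruent_copy n T S \<and> rainbow col S)"
    if n: "m * N \<le> n" for n and col :: "(nat \<Rightarrow> real) \<Rightarrow> nat"
  proof -
    define c where "c s = col (simplex_point m N w s)" for s
    have "simplex_point m N w s = simplex_point m N w t" if "\<forall>j<m. s j = t j" for s t
      using that by (auto simp: simplex_point_def fun_eq_iff less_mult_imp_div_less)
    then have "\<forall>s t. (\<forall>j<m. s j = t j) \<longrightarrow> c s = c t"
      by (metis c_def)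
    with N obtain R and h :: "nat \<Rightarrow> nat \<Rightarrow> nat" where R: "R \<subseteq> {..<m}"
      and h: "\<forall>j<m. inj_on (h j) {..<3} \<and> h j ` {..<3} \<subseteq> {..<N}"
      and cR: "\<forall>s t. (\<forall>j<m. s j < 3 \<and> t j < 3) \<longrightarrow>
        c (\<lambda>j. h j (s j)) = c (\<lambda>j. h j (t j)) \<longleftrightarrow> (\<forall>j\<in>R. s j = t j)"
      by (elim allE[of _ c] impE exE conjE) blast+
    \<comment> \<open>Switch \<open>a\<close> raises the coordinates in \<open>J\<close> from level
      0 to level 1, and switch \<open>b\<close> those in \<open>K\<close>.\<close>
    define lv where "lv J K a b j = (of_bool (a \<and> j \<in> J \<or> b \<and> j \<in> K) :: nat)"
      for J K :: "nat set" and a b :: bool and j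
    define q where "q J K a b = simplex_point m N w (\<lambda>j. h j (lv J K a b j))" for J K a b
    have lv3: "lv J K a b j < 3" for J K a b j
      by (simp add: lv_def)
    have col_q: "col (q J K a b) = col (q J K a' b') \<longleftrightarrow> (\<forall>j\<in>R. lv J K a b j = lv J K a' b' j)"
      for J K a b a' b'
      using cR[rule_format, of "lv J K a b" "lv J K a' b'"] by (simp add: lv3 c_def q_def)
    \<comment> \<open>Switching \<open>J\<close> moves \<open>M\<close> simplices of weight
      \<open>x\<close> and one of weight \<open>y\<close>, a squared distance of
      \<open>(norm u)^2\<close>; \<open>K\<close> gives \<open>(norm v)^2\<close> likewise.
      Disjointness makes the two contributions add.\<close>
    have copy: "congruent_copy n T (range (\<lambda>(a, b). q J K a b))"
      if J: "J = J1 \<union> J2" "J1 \<subseteq> W" "J2 \<subseteq> V" "card J1 = M" "card J2 = 1"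
        and K: "K = K1 \<union> K2" "K1 \<subseteq> W" "K2 \<subseteq> V" "card K1 = 1" "card K2 = M"
        and disj: "J1 \<inter> K1 = {}" "J2 \<inter> K2 = {}" for J K J1 J2 K1 K2
      unfolding T
    proof (rule congruent_copy_rectangle[OF uv])
      show "q J K a b \<in> espace n" for a b
        unfolding q_def by (rule simplex_point_in_espace[OF n])
      have JK: "J \<inter> K = {}" "J \<subseteq> {..<m}" "K \<subseteq> {..<m}"
        using J K disj WV by auto
      have fin: "finite J" "finite K" using JK finite_subset by blast+
      have weight: "(\<Sum>j\<in>L1 \<union> L2. 2 * (w j)\<^sup>2) = 2 * (card L1 * x\<^sup>2 + card L2 * y\<^sup>2)"
        if "L1 \<subseteq> W" "L2 \<subseteq> V" for L1 L2
      proof -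
        have "(\<Sum>j\<in>L1 \<union> L2. 2 * (w j)\<^sup>2) = (\<Sum>j\<in>L1. 2 * (w j)\<^sup>2) + (\<Sum>j\<in>L2. 2 * (w j)\<^sup>2)"
          using that WV by (intro sum.union_disjoint) (auto intro: finite_subset)
        also have "(\<Sum>j\<in>L1. 2 * (w j)\<^sup>2) = (\<Sum>j\<in>L1. 2 * x\<^sup>2)"
          using that by (intro sum.cong) (auto simp: w_def W_def)
        also have "(\<Sum>j\<in>L2. 2 * (w j)\<^sup>2) = (\<Sum>j\<in>L2. 2 * y\<^sup>2)"
          using that by (intro sum.cong) (auto simp: w_def V_def)
        finally show ?thesis by (simp add: algebra_simps)
      qed
      have sumJ: "(\<Sum>j\<in>J. 2 * (w j)\<^sup>2) = (norm u)\<^sup>2"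
        using weight[OF J(2,3)] J A by simp
      have sumK: "(\<Sum>j\<in>K. 2 * (w j)\<^sup>2) = (norm v)\<^sup>2"
        using weight[OF K(2,3)] K B by simp
      fix a b a' b'
      have hN: "h j (lv J K a b j) < N" if "j < m" for j a b
        using h that lv3[of J K a b j] by blast
      have neq: "h j (lv J K a b j) \<noteq> h j (lv J K a' b' j) \<longleftrightarrow> lv J K a b j \<noteq> lv J K a' b' j"
        if "j < m" for j
        using inj_on_eq_iff[of "h j" "{..<3}"] h that lv3 by simp
      have "{j. j < m \<and> h j (lv J K a b j) \<noteq> h j (lv J K a' b' j)} =
          {j. j < m \<and> lv J K a b j \<noteq> lv J K a' b' j}"
        using neq by blast
      also have "\<dots> = (if a \<noteq> a' then J else {}) \<union> (if b \<noteq> b' then K else {})"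
        using JK by (auto simp: lv_def)
      finally have "(\<Sum>j | j < m \<and> h j (lv J K a b j) \<noteq> h j (lv J K a' b' j). 2 * (w j)\<^sup>2) =
          of_bool (a \<noteq> a') * (norm u)\<^sup>2 + of_bool (b \<noteq> b') * (norm v)\<^sup>2"
        using fin JK by (simp add: sum.union_disjoint sumJ sumK)
      then show "edist n (q J K a b) (q J K a' b') =
          sqrt (of_bool (a \<noteq> a') * (norm u)\<^sup>2 + of_bool (b \<noteq> b') * (norm v)\<^sup>2)"
        unfolding q_def by (simp add: edist_simplex_point[OF n] hN)
    qed
    show ?thesis
    proof (cases "\<exists>r1\<in>R. \<exists>r2\<in>R. r1 \<noteq> r2")
      case True
      then obtain r1 r2 where r: "r1 \<in> R" "r2 \<in> R" "r1 \<noteq> r2" by blast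
      \<comment> \<open>Each of \<open>r1\<close> and \<open>r2\<close> lies in exactly one of
        \<open>W\<close> and \<open>V\<close>, so the two choices together put \<open>r1\<close>
        into \<open>J\<close> and \<open>r2\<close> into \<open>K\<close>.\<close>
      obtain J1 K1 where 1: "J1 \<subseteq> W" "K1 \<subseteq> W" "J1 \<inter> K1 = {}" "card J1 = M" "card K1 = 1"
          "r1 \<in> W \<longrightarrow> r1 \<in> J1" "r2 \<in> W \<longrightarrow> r2 \<in> K1"
        using disjoint_subsets_through[of W M 1 r1 r2] WV M r by auto
      obtain J2 K2 where 2: "J2 \<subseteq> V" "K2 \<subseteq> V" "J2 \<inter> K2 = {}" "card J2 = 1" "card K2 = M"
          "r1 \<in> V \<longrightarrow> r1 \<in> J2" "r2 \<in> V \<longrightarrow> r2 \<in> K2"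
        using disjoint_subsets_through[of V 1 M r1 r2] WV M r by auto
      define J where "J = J1 \<union> J2"
      define K where "K = K1 \<union> K2"
      have "r1 \<in> J" "r2 \<in> K" using r R WV 1 2 by (auto simp: J_def K_def)
      moreover have "J \<inter> K = {}" using 1 2 WV by (auto simp: J_def K_def)
      ultimately have "lv J K a b r1 = of_bool a" "lv J K a b r2 = of_bool b" for a b
        by (auto simp: lv_def)
      \<comment> \<open>Equal colours force equal levels at \<open>r1\<close> and at
        \<open>r2\<close>, and these levels are the switches \<open>a\<close> and \<open>b\<close>
        themselves.\<close>
      then have inj: "a = a' \<and> b = b'" if "col (q J K a b) = col (q J K a' b')" for a b a' b'
        using bspec[OF that[unfolded col_q] r(1)] bspec[OF that[unfolded col_q] r(2)]
        by (simp add: of_bool_eq_iff)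
      have "rainbow col (range (\<lambda>(a, b). q J K a b))"
        unfolding rainbow_def by (auto intro!: inj_onI dest!: inj)
      moreover have "congruent_copy n T (range (\<lambda>(a, b). q J K a b))"
        by (rule copy[OF J_def 1(1) 2(1) 1(4) 2(4) K_def 1(2) 2(2) 1(5) 2(5) 1(3) 2(3)])
      ultimately show ?thesis by blast
    next
      case False
      have "finite R" using R finite_subset by blast
      then have "card R \<le> 1" using False by (simp add: card_le_Suc0_iff_eq)
      then have cardR: "card (X - R) \<ge> M + 1" if "card X = M + 2" for X
        using that diff_card_le_card_Diff[OF \<open>finite R\<close>, of X] by linarith
      \<comment> \<open>Here 0 and 1 merely serve as two distinct indices; only sizes and
        disjointness matter.\<close>
      obtain J1 K1 where 1: "J1 \<subseteq> W - R" "K1 \<subseteq> W - R" "J1 \<inter> K1 = {}" "card J1 = M" "card K1 = 1"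
        using disjoint_subsets_through[of "W - R" M 1 0 1] WV M cardR[of W] by auto
      obtain J2 K2 where 2: "J2 \<subseteq> V - R" "K2 \<subseteq> V - R" "J2 \<inter> K2 = {}" "card J2 = 1" "card K2 = M"
        using disjoint_subsets_through[of "V - R" 1 M 0 1] WV M cardR[of V] by auto
      define J where "J = J1 \<union> J2"
      define K where "K = K1 \<union> K2"
      have "lv J K a b j = 0" if "j \<in> R" for a b j
        using that 1 2 by (auto simp: lv_def J_def K_def)
      then have "col (q J K a b) = col (q J K True True)" for a b
        by (simp add: col_q)
      then have "Defs.monochromatic col (range (\<lambda>(a, b). q J K a b))"
        unfolding Defs.monochromatic_def constant_on_def
        by (intro exI[of _ "col (q J K True True)"]) auto
      moreover have "congruent_copy n T (range (\<lambda>(a, b). q J K a b))"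
        by (rule copy[OF J_def _ _ 1(4) 2(4) K_def _ _ 1(5) 2(5) 1(3) 2(3)]) (use 1 2 in auto)
      ultimately show ?thesis by blast
    qed
  qed
  \<comment> \<open>\<open>m * N\<close> was fixed before any colouring or number of colours, so it
    serves as \<open>n0\<close> for every \<open>r\<close>.\<close>
  show ?thesis
    unfolding GR_arrow_def by (intro exI[of _ "m * N"] allI impI ballI main)
qed

end
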